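(* Let $T$ and $P$ be strings and let $A[1..N]$ be a set of anchors that are exact matches between $T$ and $P$. Then \[ \max_{1\le i\le N}\ \max_{\text{weak chains } S \text{ ending at } A[i]}\mathtt{coverage}(S) \] equals the length of an anchor-restricted longest common subsequence of $T$ and $P$ with respect to $A$.
   Context: An anchor is an interval pair $I=([I.a..I.b],[I.c..I.d])$ with positive integer endpoints; it is an exact match between $T$ and $P$ if $I.b-I.a=I.d-I.c$ and $T[I.a..I.b]=P[I.c..I.d]$. Weak precedence: $I'\prec^w I$ iff $I'.a<I.a$ and $I'.c<I.c$. A weak chain ending at $A[i]$ is a sequence $S[1..n]$ ($n\ge1$) of anchors from $A$ with $S[j-1]\prec^w S[j]$ for all $1<j\le n$ and $S[n]=A[i]$, and \[ \mathtt{coverage}(S)=\sum_{j=1}^{n-1}\min\Big(\min(S[j+1].a,S[j].b+1)-S[j].a,\ \min(S[j+1].c,S[j].d+1)-S[j].c\Big)+\min\big(S[n].b-S[n].a+1,\ S[n].d-S[n].c+1\big). \] A string $C[1..\ell]$ is an anchor-restricted common subsequence of $T$ and $P$ if there are indices $1\le i_1<\dots<i_\ell\le|T|$ and $1\le j_1<\dots<j_\ell\le|P|$ with $C[k]=T[i_k]=P[j_k]$ for all $k$, such that for each $k$ there is an anchor $([a..b],[c..d])$ in $A$ and an integer $x$ with $0\le x\le b-a$, $a+x=i_k$ and $c+x=j_k$. An anchor-restricted longest common subsequence is one of maximum length $\ell$. *)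

theory Defs
  imports Main
begin

text \<open>Strings are lists over an arbitrary alphabet. All positions are 1-based.\<close>

abbreviation nth1 :: "'a list \<Rightarrow> nat \<Rightarrow> 'a" where
  "nth1 xs k \<equiv> xs ! (k - 1)"

abbreviation factor :: "'a list \<Rightarrow> nat \<Rightarrow> nat \<Rightarrow> 'a list" where
  "factor xs i j \<equiv> map (nth1 xs) [i..<Suc j]"

text \<open>The interval pair \<open>([a..b], [c..d])\<close>.\<close>

datatype anchor = Anchor (start_T: nat) (end_T: nat) (start_P: nat) (end_P: nat)

definition is_anchor :: "anchor \<Rightarrow> bool" where
  "is_anchor I \<longleftrightarrow> 1 \<le> start_T I \<and> start_T I \<le> end_T I \<and> 1 \<le> start_P I \<and> start_P I \<le> end_P I"

text \<open>The two bounds on the end points are needed for \<open>T[a..b]\<close> and \<open>P[c..d]\<close> to be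
  genuine substrings.\<close>

definition exact_match :: "'a list \<Rightarrow> 'a list \<Rightarrow> anchor \<Rightarrow> bool" where
  "exact_match T P I \<longleftrightarrow>
     end_T I \<le> length T \<and> end_P I \<le> length P \<and>
     end_T I - start_T I = end_P I - start_P I \<and>
     factor T (start_T I) (end_T I) = factor P (start_P I) (end_P I)"

definition weak_prec :: "anchor \<Rightarrow> anchor \<Rightarrow> bool" where
  "weak_prec I' I \<longleftrightarrow> start_T I' < start_T I \<and> start_P I' < start_P I"

definition weak_chain :: "anchor list \<Rightarrow> nat \<Rightarrow> anchor list \<Rightarrow> bool" where
  "weak_chain A i S \<longleftrightarrow>
     1 \<le> length S \<and> set S \<subseteq> set A \<and>
     (\<forall>j. 1 < j \<and> j \<le> length S \<longrightarrow> weak_prec (nth1 S (j - 1)) (nth1 S j)) \<and>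
     nth1 S (length S) = nth1 A i"

text \<open>Integer-valued, so that no subtraction is truncated.\<close>

definition coverage :: "anchor list \<Rightarrow> int" where
  "coverage S =
     (let n = length S;
          a = (\<lambda>j. int (start_T (nth1 S j))); b = (\<lambda>j. int (end_T (nth1 S j)));
          c = (\<lambda>j. int (start_P (nth1 S j))); d = (\<lambda>j. int (end_P (nth1 S j)))
      in (\<Sum>j = 1..n - 1. min (min (a (j + 1)) (b j + 1) - a j) (min (c (j + 1)) (d j + 1) - c j))
         + min (b n - a n + 1) (d n - c n + 1))"

text \<open>The maximum over an empty anchor set is taken to be 0. Otherwise both maxima range over
  finite nonempty sets: weak precedence is strict, so there are finitely many weak chains, and
  the singleton \<open>[A[i]]\<close> is one of them.\<close>

definition max_coverage :: "anchor list \<Rightarrow> int" where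
  "max_coverage A =
     (if A = [] then 0
      else Max ((\<lambda>i. Max {coverage S | S. weak_chain A i S}) ` {1..length A}))"

definition restricted_common_subseq ::
  "anchor list \<Rightarrow> 'a list \<Rightarrow> 'a list \<Rightarrow> 'a list \<Rightarrow> bool" where
  "restricted_common_subseq A T P C \<longleftrightarrow>
     (\<exists>i j :: nat \<Rightarrow> nat.
        strict_mono_on {1..length C} i \<and> i ` {1..length C} \<subseteq> {1..length T} \<and>
        strict_mono_on {1..length C} j \<and> j ` {1..length C} \<subseteq> {1..length P} \<and>
        (\<forall>k\<in>{1..length C}.
           nth1 C k = nth1 T (i k) \<and> nth1 T (i k) = nth1 P (j k) \<and>
           (\<exists>I\<in>set A. \<exists>x. x \<le> end_T I - start_T I \<and>
              start_T I + x = i k \<and> start_P I + x = j k)))"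

definition restricted_lcs :: "anchor list \<Rightarrow> 'a list \<Rightarrow> 'a list \<Rightarrow> 'a list \<Rightarrow> bool" where
  "restricted_lcs A T P C \<longleftrightarrow>
     restricted_common_subseq A T P C \<and>
     (\<forall>C'. restricted_common_subseq A T P C' \<longrightarrow> length C' \<le> length C)"

end

theory Submission
  imports Defs
begin

text \<open>Identify an anchor-restricted common subsequence with a list of strictly increasing points,
  each lying on the diagonal segment of some anchor. A weak chain yields such a list: from each
  anchor but the last take as many initial points as stay strictly below the start of the next
  anchor. Conversely, let the last of the given points be the \<open>y\<close>-th one (counting from 0) of an
  anchor \<open>J\<close>. The points that are not strictly below the start of \<open>J\<close> all reach it in the same
  coordinate, so there are at most \<open>y + 1\<close> of them. The remaining points lie on a chain by
  induction, and this chain can be extended by \<open>J\<close> since the anchor of any point strictly below the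
  start of \<open>J\<close> weakly precedes \<open>J\<close>.\<close>

section \<open>Coverage as a sum of gaps\<close>

definition gap :: "anchor \<Rightarrow> anchor \<Rightarrow> int" where
  "gap I J = min (min (int (start_T J)) (int (end_T I) + 1) - int (start_T I))
                 (min (int (start_P J)) (int (end_P I) + 1) - int (start_P I))"

definition anchor_size :: "anchor \<Rightarrow> int" where
  "anchor_size I = min (int (end_T I) - int (start_T I) + 1) (int (end_P I) - int (start_P I) + 1)"

text \<open>The last summand of \<open>coverage\<close> is kept apart because it changes when a
  chain is extended. Without it, appending an anchor just adds one \<open>gap\<close>, which suits
  induction from the right.\<close>

definition inner_coverage :: "anchor list \<Rightarrow> int" where
  "inner_coverage S = (\<Sum>j = 1..length S - 1. gap (nth1 S j) (nth1 S (j + 1)))"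

lemma coverage_eq:
  assumes "S \<noteq> []"
  shows "coverage S = inner_coverage S + anchor_size (last S)"
  using assms
  by (simp add: coverage_def inner_coverage_def anchor_size_def gap_def Let_def last_conv_nth)

lemma inner_coverage_singleton [simp]: "inner_coverage [I] = 0"
  by (simp add: inner_coverage_def)

lemma inner_coverage_snoc:
  assumes "S \<noteq> []"
  shows "inner_coverage (S @ [J]) = inner_coverage S + gap (last S) J"
proof -
  obtain m where m: "length S = Suc m" using assms by (cases S) auto
  have "inner_coverage (S @ [J]) =
      (\<Sum>j = 1..Suc m. gap (nth1 (S @ [J]) j) (nth1 (S @ [J]) (j + 1)))"
    by (simp add: inner_coverage_def m)
  also have "\<dots> = (\<Sum>j = 1..m. gap (nth1 (S @ [J]) j) (nth1 (S @ [J]) (j + 1))) + gap (last S) J"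
    using assms m by (simp add: nth_append last_conv_nth)
  also have "(\<Sum>j = 1..m. gap (nth1 (S @ [J]) j) (nth1 (S @ [J]) (j + 1))) = inner_coverage S"
    unfolding inner_coverage_def m by (rule sum.cong) (auto simp: nth_append m)
  finally show ?thesis .
qed

section \<open>Weak chains and the nested maxima\<close>

lemma successively_nth1_iff:
  "successively R S \<longleftrightarrow> (\<forall>j. 1 < j \<and> j \<le> length S \<longrightarrow> R (nth1 S (j - 1)) (nth1 S j))"
proof -
  have "(\<forall>i. Suc i < length S \<longrightarrow> R (S ! i) (S ! Suc i)) \<longleftrightarrow>
      (\<forall>j. 1 < j \<and> j \<le> length S \<longrightarrow> R (nth1 S (j - 1)) (nth1 S j))" (is "?L \<longleftrightarrow> ?R")
  proof
    assume L: ?L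
    show ?R
    proof (intro allI impI)
      fix j assume j: "1 < j \<and> j \<le> length S"
      then obtain i where "j = Suc (Suc i)" by (auto dest: less_imp_Suc_add)
      then show "R (nth1 S (j - 1)) (nth1 S j)" using L[rule_format, of i] j by simp
    qed
  next
    assume R: ?R
    show ?L
    proof (intro allI impI)
      fix i assume "Suc i < length S"
      then show "R (S ! i) (S ! Suc i)" using R[rule_format, of "Suc (Suc i)"] by simp
    qed
  qed
  then show ?thesis by (simp add: successively_conv_nth)
qed

lemma weak_chain_iff:
  "weak_chain A i S \<longleftrightarrow>
     S \<noteq> [] \<and> set S \<subseteq> set A \<and> successively weak_prec S \<and> last S = nth1 A i"
  unfolding weak_chain_def successively_nth1_iff by (cases S) (auto simp: last_conv_nth)

lemma transp_weak_prec: "transp weak_prec"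
  by (auto simp: transp_def weak_prec_def)

text \<open>By transitivity consecutive comparisons extend to all pairs, and
  \<open>weak_prec\<close> is irreflexive. Hence a finite anchor set admits only finitely many
  chains.\<close>

lemma successively_weak_prec_distinct:
  assumes "successively weak_prec S"
  shows "distinct S"
proof -
  have "sorted_wrt weak_prec S"
    using assms transp_weak_prec by (simp add: successively_conv_sorted_wrt)
  then show ?thesis
    by (induction S) (auto simp: weak_prec_def)
qed

lemma finite_weak_chains: "finite {S. weak_chain A i S}"
proof (rule finite_subset)
  show "{S. weak_chain A i S} \<subseteq> {S. set S \<subseteq> set A \<and> distinct S}"
    by (auto simp: weak_chain_iff successively_weak_prec_distinct)
  show "finite {S. set S \<subseteq> set A \<and> distinct S}"
    by (rule finite_subset_distinct) simp
qed

text \<open>Eliminates both \<open>Max\<close> operators: one chain attaining \<open>n\<close> and a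
  bound on all chains suffice. The end index is recovered from the position of \<open>last S\<close>
  in \<open>A\<close>.\<close>

lemma max_coverage_eqI:
  assumes "S \<noteq> []" "set S \<subseteq> set A" "successively weak_prec S" "n \<le> coverage S"
    and bound: "\<And>S. S \<noteq> [] \<Longrightarrow> set S \<subseteq> set A \<Longrightarrow> successively weak_prec S \<Longrightarrow> coverage S \<le> n"
  shows "max_coverage A = n"
proof -
  let ?M = "\<lambda>i. Max {coverage S | S. weak_chain A i S}"
  have A: "A \<noteq> []" using assms(1,2) by auto
  have fin: "finite {coverage S | S. weak_chain A i S}" for i
    using finite_weak_chains[of A i] by simp
  have ub: "?M i \<le> n" if "i \<in> {1..length A}" for i
  proof -
    \<comment> \<open>The singleton chain makes the inner set nonempty, so that
      \<open>Max_le_iff\<close> applies.\<close>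
    have "weak_chain A i [nth1 A i]"
      using that by (auto simp: weak_chain_iff)
    then have "{coverage S | S. weak_chain A i S} \<noteq> {}" by blast
    then show ?thesis
      using fin bound by (auto simp: Max_le_iff weak_chain_iff)
  qed
  have "last S \<in> set A" using assms(1,2) last_in_set by blast
  then obtain k where k: "k < length A" "A ! k = last S" by (auto simp: in_set_conv_nth)
  then have "weak_chain A (Suc k) S" using assms(1-3) by (simp add: weak_chain_iff)
  then have ge: "n \<le> ?M (Suc k)" using fin assms(4) by (intro order.trans[OF _ Max_ge]) auto
  have k_in: "Suc k \<in> {1..length A}" using k by simp
  have "n = ?M (Suc k)" using ge ub[OF k_in] by (rule antisym)
  then have "n \<in> ?M ` {1..length A}" using k_in by (rule image_eqI)
  then have "Max (?M ` {1..length A}) = n"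
    using ub by (intro Max_eqI) auto
  then show ?thesis using A by (simp add: max_coverage_def)
qed

section \<open>Points on anchor diagonals\<close>

definition below :: "nat \<times> nat \<Rightarrow> nat \<times> nat \<Rightarrow> bool" where
  "below p q \<longleftrightarrow> fst p < fst q \<and> snd p < snd q"

abbreviation point :: "anchor \<Rightarrow> nat \<Rightarrow> nat \<times> nat" where
  "point I x \<equiv> (start_T I + x, start_P I + x)"

definition points :: "anchor list \<Rightarrow> (nat \<times> nat) set" where
  "points A = {point I x | I x. I \<in> set A \<and> x \<le> end_T I - start_T I}"

lemma pointsI: "I \<in> set A \<Longrightarrow> x \<le> end_T I - start_T I \<Longrightarrow> point I x \<in> points A"
  by (auto simp: points_def)

lemma pointsE:
  assumes "p \<in> points A"
  obtains I x where "I \<in> set A" "x \<le> end_T I - start_T I" "p = point I x"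
  using assms by (auto simp: points_def)

section \<open>From chains to increasing points\<close>

lemma sorted_wrt_initial_points: "sorted_wrt below (map (point I) [0..<n])"
  by (simp add: sorted_wrt_map sorted_wrt_iff_nth_less below_def)

text \<open>The last anchor contributes no points yet. Keeping all points strictly below its start
  is the invariant that allows its own initial points to be appended once a successor is
  known.\<close>

lemma chain_inner_points:
  assumes "S \<noteq> []" "set S \<subseteq> set A" "successively weak_prec S"
    and "\<And>I. I \<in> set A \<Longrightarrow> is_anchor I"
  shows "\<exists>ps. sorted_wrt below ps \<and> set ps \<subseteq> points A \<and> int (length ps) = inner_coverage S \<and>
           (\<forall>p\<in>set ps. below p (point (last S) 0))"
  using assms(1-3)
proof (induction S rule: rev_nonempty_induct)
  case (single I)
  show ?case by (rule exI[of _ "[]"]) simp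
next
  case (snoc J S)
  let ?I = "last S"
  have IA: "?I \<in> set A" using snoc.hyps snoc.prems(1) last_in_set by fastforce
  have anchor: "is_anchor ?I" using assms(4) IA .
  have prec: "weak_prec ?I J" and succ: "successively weak_prec S"
    using snoc.prems(2) snoc.hyps by (auto simp: successively_append_iff)
  obtain ps where ps: "sorted_wrt below ps" "set ps \<subseteq> points A"
      "int (length ps) = inner_coverage S" "\<forall>p\<in>set ps. below p (point ?I 0)"
    using snoc.IH succ snoc.prems(1) by auto
  \<comment> \<open>\<open>gap ?I J\<close> counts the initial points of \<open>?I\<close> that lie
    within both of its intervals and strictly below the start of \<open>J\<close>. It is positive
    because \<open>?I\<close> is an anchor weakly preceding \<open>J\<close>, so \<open>nat\<close>
    loses nothing.\<close>
  define g where "g = nat (gap ?I J)"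
  have g: "int g = gap ?I J"
    using prec anchor by (simp add: g_def gap_def weak_prec_def is_anchor_def)
  have in_I: "x \<le> end_T ?I - start_T ?I"
    and below_J: "below (point ?I x) (point J 0)" if "x < g" for x
  proof -
    have "int x < gap ?I J" using that g by simp
    then show "x \<le> end_T ?I - start_T ?I" "below (point ?I x) (point J 0)"
      by (auto simp: gap_def below_def)
  qed
  let ?qs = "map (point ?I) [0..<g]"
  have "sorted_wrt below (ps @ ?qs)"
    using ps(1,4) sorted_wrt_initial_points
    by (fastforce simp: sorted_wrt_append below_def)
  moreover have "set (ps @ ?qs) \<subseteq> points A"
    using ps(2) pointsI[OF IA in_I] by auto
  moreover have "int (length (ps @ ?qs)) = inner_coverage (S @ [J])"
    using ps(3) g snoc.hyps by (simp add: inner_coverage_snoc)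
  moreover have "\<forall>p\<in>set (ps @ ?qs). below p (point J 0)"
    using ps(4) below_J prec by (fastforce simp: below_def weak_prec_def)
  ultimately show ?case by (metis last_snoc)
qed

text \<open>With no successor to stay below, the last anchor supplies \<open>anchor_size\<close>
  further points, which is exactly the final summand of \<open>coverage\<close>.\<close>

lemma chain_points:
  assumes "S \<noteq> []" "set S \<subseteq> set A" "successively weak_prec S"
    and "\<And>I. I \<in> set A \<Longrightarrow> is_anchor I"
  shows "\<exists>ps. sorted_wrt below ps \<and> set ps \<subseteq> points A \<and> int (length ps) = coverage S"
proof -
  let ?I = "last S"
  have IA: "?I \<in> set A" using assms(1,2) last_in_set by blast
  have anchor: "is_anchor ?I" using assms(4) IA .
  obtain ps where ps: "sorted_wrt below ps" "set ps \<subseteq> points A"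
      "int (length ps) = inner_coverage S" "\<forall>p\<in>set ps. below p (point ?I 0)"
    using chain_inner_points[OF assms] by blast
  define g where "g = nat (anchor_size ?I)"
  have g: "int g = anchor_size ?I"
    using anchor by (simp add: g_def anchor_size_def is_anchor_def)
  have in_I: "x \<le> end_T ?I - start_T ?I" if "x < g" for x
  proof -
    have "int x < anchor_size ?I" using that g by simp
    then show ?thesis by (auto simp: anchor_size_def)
  qed
  let ?qs = "map (point ?I) [0..<g]"
  have "sorted_wrt below (ps @ ?qs)"
    using ps(1,4) sorted_wrt_initial_points
    by (fastforce simp: sorted_wrt_append below_def)
  moreover have "set (ps @ ?qs) \<subseteq> points A"
    using ps(2) pointsI[OF IA in_I] by auto
  moreover have "int (length (ps @ ?qs)) = coverage S"
    using ps(3) g assms(1) by (simp add: coverage_eq)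
  ultimately show ?thesis by blast
qed

section \<open>From increasing points to chains\<close>

lemma sorted_wrt_below_cases:
  assumes "sorted_wrt below ps" "p \<in> set ps" "q \<in> set ps"
  shows "p = q \<or> below p q \<or> below q p"
  using assms by (induction ps) auto

lemma sorted_wrt_below_distinct:
  assumes "sorted_wrt below ps"
  shows "distinct (map fst ps)" "distinct (map snd ps)"
  using assms by (induction ps) (auto simp: below_def)

text \<open>Once a single coordinate is known to have reached its bound at all points, its values
  are distinct and lie among \<open>y + 1\<close> consecutive numbers.\<close>

lemma length_not_below_le:
  assumes sorted: "sorted_wrt below ps"
    and "\<And>p. p \<in> set ps \<Longrightarrow> \<not> below p (a, c)"
    and ub: "\<And>p. p \<in> set ps \<Longrightarrow> fst p \<le> a + y \<and> snd p \<le> c + y"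
  shows "length ps \<le> y + 1"
proof -
  have interval: "length ns \<le> y + 1" if "distinct ns" "set ns \<subseteq> {b..b + y}" for ns b
    using that card_mono[OF _ that(2)] by (simp add: distinct_card)
  have "(\<forall>p\<in>set ps. a \<le> fst p) \<or> (\<forall>p\<in>set ps. c \<le> snd p)"
  proof (rule ccontr)
    assume "\<not> ?thesis"
    then obtain p q where pq: "p \<in> set ps" "q \<in> set ps" "fst p < a" "snd q < c"
      by (auto simp: not_le)
    \<comment> \<open>Not being below \<open>(a, c)\<close> forces \<open>c \<le> snd p\<close> and
      \<open>a \<le> fst q\<close>. So \<open>p\<close> is left of \<open>q\<close> but above it,
      and the two are incomparable.\<close>
    with assms(2)[of p] assms(2)[of q] sorted_wrt_below_cases[OF sorted pq(1,2)]
    show False by (auto simp: below_def)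
  qed
  then show ?thesis
  proof
    assume "\<forall>p\<in>set ps. a \<le> fst p"
    then have "set (map fst ps) \<subseteq> {a..a + y}" using ub by auto
    from interval[OF sorted_wrt_below_distinct(1)[OF sorted] this] show ?thesis by simp
  next
    assume "\<forall>p\<in>set ps. c \<le> snd p"
    then have "set (map snd ps) \<subseteq> {c..c + y}" using ub by auto
    from interval[OF sorted_wrt_below_distinct(2)[OF sorted] this] show ?thesis by simp
  qed
qed

text \<open>The bound credits \<open>J\<close> with \<open>y + 1\<close> points instead of its full
  size. In the recursive call this partial credit is what the \<open>gap\<close> to the next anchor
  can pay for. The induction is on length because the recursion passes to a filtered list.\<close>

lemma points_chain_ending_at:
  assumes "sorted_wrt below ps" "set ps \<subseteq> points A" "ps \<noteq> []" "last ps = point J y"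
    and "J \<in> set A" "y \<le> end_T J - start_T J"
    and equal_size: "\<And>I. I \<in> set A \<Longrightarrow> is_anchor I \<and> end_T I - start_T I = end_P I - start_P I"
  shows "\<exists>S. S \<noteq> [] \<and> set S \<subseteq> set A \<and> successively weak_prec S \<and> last S = J \<and>
           int (length ps) \<le> inner_coverage S + int y + 1"
  using assms(1-6)
proof (induction "length ps" arbitrary: ps J y rule: less_induct)
  case less
  let ?low = "\<lambda>p. below p (point J 0)"
  define qs where "qs = filter ?low ps"
  define rs where "rs = filter (\<lambda>p. \<not> ?low p) ps"
  have len: "length qs + length rs = length ps"
    unfolding qs_def rs_def by (rule sum_length_filter_compl)
  have split: "ps = butlast ps @ [point J y]"
    using less.prems(3,4) by (metis append_butlast_last_id)
  have le_last: "fst p \<le> start_T J + y \<and> snd p \<le> start_P J + y" if "p \<in> set ps" for p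
  proof -
    have "sorted_wrt below (butlast ps @ [point J y])" using less.prems(1) split by simp
    then have "\<forall>q\<in>set (butlast ps). below q (point J y)" by (simp add: sorted_wrt_append)
    moreover have "p \<in> set (butlast ps) \<or> p = point J y"
      using that by (subst (asm) split) auto
    ultimately show ?thesis by (auto simp: below_def)
  qed
  have rs_len: "length rs \<le> y + 1"
  proof (rule length_not_below_le)
    show "sorted_wrt below rs" using less.prems(1) by (simp add: rs_def sorted_wrt_filter)
    show "\<not> below p (start_T J, start_P J)" if "p \<in> set rs" for p
      using that by (simp add: rs_def)
    show "fst p \<le> start_T J + y \<and> snd p \<le> start_P J + y" if "p \<in> set rs" for p
      using that le_last by (simp add: rs_def)
  qed
  show ?case
  proof (cases "qs = []")
    case True
    \<comment> \<open>All points are in \<open>rs\<close>, so \<open>J\<close> alone accounts for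
      them.\<close>
    then show ?thesis
      using len rs_len less.prems(5) by (intro exI[of _ "[J]"]) simp
  next
    case False
    \<comment> \<open>The last point lies on \<open>J\<close> and hence is not below its start, so
      \<open>qs\<close> is strictly shorter than \<open>ps\<close>.\<close>
    have "last ps \<in> set rs"
      using less.prems(3,4) last_in_set[OF less.prems(3)] by (simp add: rs_def below_def)
    then have smaller: "length qs < length ps" using len by (cases rs) auto
    have last_qs: "last qs \<in> set ps" "below (last qs) (point J 0)"
      using last_in_set[OF False] by (auto simp: qs_def)
    obtain I x where I: "I \<in> set A" "x \<le> end_T I - start_T I" "last qs = point I x"
      using subsetD[OF less.prems(2) last_qs(1)] by (elim pointsE)
    have "sorted_wrt below qs" "set qs \<subseteq> points A"
      using less.prems(1,2) by (auto simp: qs_def sorted_wrt_filter)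
    from less.hyps[OF smaller this False I(3,1,2)]
    obtain S where S: "S \<noteq> []" "set S \<subseteq> set A" "successively weak_prec S" "last S = I"
        "int (length qs) \<le> inner_coverage S + int x + 1"
      by blast
    \<comment> \<open>The start of \<open>I\<close> is at most \<open>last qs\<close> in each
      coordinate, and \<open>last qs\<close> is strictly below the start of
      \<open>J\<close>.\<close>
    have "weak_prec I J" using last_qs(2) I(3) by (simp add: below_def weak_prec_def)
    then have "successively weak_prec (S @ [J])"
      using S by (simp add: successively_append_iff)
    \<comment> \<open>The points \<open>0\<close> to \<open>x\<close> of \<open>I\<close> all
      precede the start of \<open>J\<close>. Equal interval lengths carry the bound on
      \<open>x\<close> from the \<open>T\<close> side to the \<open>P\<close> side.\<close>
    moreover have "int x + 1 \<le> gap I J"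
      using last_qs(2) I equal_size[OF I(1)] by (auto simp: below_def gap_def is_anchor_def)
    then have "int (length ps) \<le> inner_coverage (S @ [J]) + int y + 1"
      using S len rs_len by (simp add: inner_coverage_snoc)
    ultimately show ?thesis
      using S(2) less.prems(5) by (intro exI[of _ "S @ [J]"]) simp
  qed
qed

lemma points_chain:
  assumes "A \<noteq> []" "sorted_wrt below ps" "set ps \<subseteq> points A"
    and equal_size: "\<And>I. I \<in> set A \<Longrightarrow> is_anchor I \<and> end_T I - start_T I = end_P I - start_P I"
  shows "\<exists>S. S \<noteq> [] \<and> set S \<subseteq> set A \<and> successively weak_prec S \<and>
           int (length ps) \<le> coverage S"
proof (cases "ps = []")
  case True
  \<comment> \<open>A chain must be nonempty even when there are no points; any anchor serves, its
    size being nonnegative.\<close>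
  have "is_anchor (hd A)" using equal_size assms(1) by simp
  then show ?thesis
    using True assms(1)
    by (intro exI[of _ "[hd A]"]) (simp add: coverage_eq anchor_size_def is_anchor_def)
next
  case False
  then obtain J y where J: "J \<in> set A" "y \<le> end_T J - start_T J" "last ps = point J y"
    using subsetD[OF assms(3) last_in_set[OF False]] by (elim pointsE)
  obtain S where S: "S \<noteq> []" "set S \<subseteq> set A" "successively weak_prec S" "last S = J"
      "int (length ps) \<le> inner_coverage S + int y + 1"
    using points_chain_ending_at[OF assms(2,3) False J(3,1,2) equal_size] by blast
  have "int y + 1 \<le> anchor_size J"
    using J(2) equal_size[OF J(1)] by (auto simp: anchor_size_def is_anchor_def)
  then show ?thesis using S by (intro exI[of _ S]) (simp add: coverage_eq)
qed

section \<open>Increasing points as common subsequences\<close>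

lemma points_of_common_subseq:
  assumes "restricted_common_subseq A T P C"
  shows "\<exists>ps. sorted_wrt below ps \<and> set ps \<subseteq> points A \<and> length ps = length C"
proof -
  obtain i j :: "nat \<Rightarrow> nat" where ij: "strict_mono_on {1..length C} i"
      "strict_mono_on {1..length C} j"
      "\<forall>k\<in>{1..length C}. nth1 C k = nth1 T (i k) \<and> nth1 T (i k) = nth1 P (j k) \<and>
         (\<exists>I\<in>set A. \<exists>x. x \<le> end_T I - start_T I \<and> start_T I + x = i k \<and> start_P I + x = j k)"
    using assms unfolding restricted_common_subseq_def by (elim exE conjE)
  \<comment> \<open>\<open>Suc\<close> bridges the 0-based list and the 1-based index
    functions.\<close>
  let ?ps = "map (\<lambda>k. (i (Suc k), j (Suc k))) [0..<length C]"
  have "sorted_wrt below ?ps"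
    using strict_mono_onD[OF ij(1)] strict_mono_onD[OF ij(2)]
    by (simp add: sorted_wrt_iff_nth_less below_def)
  moreover have "set ?ps \<subseteq> points A"
  proof
    fix p assume "p \<in> set ?ps"
    then obtain k where k: "k < length C" "p = (i (Suc k), j (Suc k))" by auto
    then obtain I x where "I \<in> set A" "x \<le> end_T I - start_T I"
        "start_T I + x = i (Suc k)" "start_P I + x = j (Suc k)"
      using bspec[OF ij(3), of "Suc k"] by auto
    then show "p \<in> points A" using pointsI[of I A x] k(2) by simp
  qed
  ultimately show ?thesis by (intro exI[of _ ?ps]) simp
qed

lemma exact_match_point:
  assumes "is_anchor I" "exact_match T P I" "x \<le> end_T I - start_T I"
  shows "start_T I + x \<in> {1..length T}" "start_P I + x \<in> {1..length P}"
    and "nth1 T (start_T I + x) = nth1 P (start_P I + x)"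
proof -
  show "start_T I + x \<in> {1..length T}" "start_P I + x \<in> {1..length P}"
    using assms by (auto simp: is_anchor_def exact_match_def)
  \<comment> \<open>Both factors have length greater than \<open>x\<close>, so equality of the
    factors can be read off at entry \<open>x\<close>.\<close>
  have "x < Suc (end_T I) - start_T I" "x < Suc (end_P I) - start_P I"
    using assms by (auto simp: is_anchor_def exact_match_def)
  then have "factor T (start_T I) (end_T I) ! x = nth1 T (start_T I + x)"
      "factor P (start_P I) (end_P I) ! x = nth1 P (start_P I + x)"
    by (simp_all del: upt_Suc)
  then show "nth1 T (start_T I + x) = nth1 P (start_P I + x)"
    using assms(2) unfolding exact_match_def by argo
qed

text \<open>The coordinates of the points serve as index functions: \<open>below\<close> makes both
  strictly increasing, and exact matching makes the letters agree.\<close>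

lemma common_subseq_of_points:
  fixes T P :: "'a list"
  assumes sorted: "sorted_wrt below ps" and sub: "set ps \<subseteq> points A"
    and "\<And>I. I \<in> set A \<Longrightarrow> is_anchor I"
    and "\<And>I. I \<in> set A \<Longrightarrow> exact_match T P I"
  shows "\<exists>C. restricted_common_subseq A T P C \<and> length C = length ps"
proof -
  let ?C = "map (\<lambda>p. nth1 T (fst p)) ps"
  let ?i = "\<lambda>k. fst (nth1 ps k)" and ?j = "\<lambda>k. snd (nth1 ps k)"
  have below: "below (nth1 ps k) (nth1 ps l)" if "k \<in> {1..length ps}" "l \<in> {1..length ps}" "k < l" for k l
    using that sorted by (auto simp: sorted_wrt_iff_nth_less)
  have point: "\<exists>I\<in>set A. \<exists>x. x \<le> end_T I - start_T I \<and> nth1 ps k = point I x"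
    if "k \<in> {1..length ps}" for k
  proof -
    have "nth1 ps k \<in> points A" using sub that by (auto intro!: subsetD[OF sub] nth_mem)
    then show ?thesis by (auto simp: points_def)
  qed
  have match: "?i k \<in> {1..length T} \<and> ?j k \<in> {1..length P} \<and> nth1 T (?i k) = nth1 P (?j k)"
    if "k \<in> {1..length ps}" for k
  proof -
    obtain I x where I: "I \<in> set A" "x \<le> end_T I - start_T I" "nth1 ps k = point I x"
      using point[OF \<open>k \<in> {1..length ps}\<close>] by blast
    show ?thesis
      using exact_match_point[OF assms(3,4)[OF I(1)] I(2)] I(3) by simp
  qed
  have "restricted_common_subseq A T P ?C"
    unfolding restricted_common_subseq_def
  proof (rule exI[of _ ?i], rule exI[of _ ?j], intro conjI ballI)
    show "strict_mono_on {1..length ?C} ?i" "strict_mono_on {1..length ?C} ?j"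
      using below by (auto intro!: strict_mono_onI simp: below_def)
    show "?i ` {1..length ?C} \<subseteq> {1..length T}" "?j ` {1..length ?C} \<subseteq> {1..length P}"
      using match by auto
  next
    fix k assume "k \<in> {1..length ?C}"
    then have k: "k \<in> {1..length ps}" by simp
    then show "nth1 ?C k = nth1 T (?i k)" by auto
    show "nth1 T (?i k) = nth1 P (?j k)" using match[OF k] by blast
    show "\<exists>I\<in>set A. \<exists>x. x \<le> end_T I - start_T I \<and> start_T I + x = ?i k \<and> start_P I + x = ?j k"
      using point[OF k] by fastforce
  qed
  then show ?thesis by (intro exI[of _ ?C]) simp
qed

section \<open>Existence of a longest subsequence and the equality\<close>

lemma length_common_subseq_le:
  assumes "restricted_common_subseq A T P C"
  shows "length C \<le> length T"
proof -
  obtain i :: "nat \<Rightarrow> nat" where "strict_mono_on {1..length C} i"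
      "i ` {1..length C} \<subseteq> {1..length T}"
    using assms unfolding restricted_common_subseq_def by (elim exE conjE)
  then have "card {1..length C} \<le> card {1..length T}"
    by (intro card_inj_on_le[of i]) (auto intro: strict_mono_on_imp_inj_on)
  then show ?thesis by simp
qed

text \<open>The empty string always qualifies and lengths are bounded by \<open>length T\<close>, so
  a maximum is attained.\<close>

lemma restricted_lcs_exists: "\<exists>C. restricted_lcs A T P C"
proof -
  have "restricted_common_subseq A T P []"
    by (auto simp: restricted_common_subseq_def)
  then show ?thesis
    unfolding restricted_lcs_def
    using ex_has_greatest_nat[of "restricted_common_subseq A T P" "[]" length "Suc (length T)"]
      length_common_subseq_le[of A T P] by (auto simp: less_Suc_eq_le)
qed

theorem theorem3:
  fixes T P :: "'a list" and A :: "anchor list"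
  assumes "distinct A"
    and "\<And>I. I \<in> set A \<Longrightarrow> is_anchor I"
    and "\<And>I. I \<in> set A \<Longrightarrow> exact_match T P I"
  shows "(\<exists>C. restricted_lcs A T P C) \<and>
         (\<forall>C. restricted_lcs A T P C \<longrightarrow> max_coverage A = int (length C))"
proof (intro conjI allI impI)
  show "\<exists>C. restricted_lcs A T P C" by (rule restricted_lcs_exists)
next
  fix C assume lcs: "restricted_lcs A T P C"
  then obtain ps where ps: "sorted_wrt below ps" "set ps \<subseteq> points A" "length ps = length C"
    using points_of_common_subseq restricted_lcs_def by blast
  show "max_coverage A = int (length C)"
  proof (cases "A = []")
    case True
    \<comment> \<open>Without anchors there are no points, so \<open>C\<close> is empty, in
      agreement with the default value 0.\<close>
    then show ?thesis using ps by (simp add: max_coverage_def points_def)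
  next
    case False
    have "is_anchor I \<and> end_T I - start_T I = end_P I - start_P I" if "I \<in> set A" for I
      using assms(2,3)[OF that] by (simp add: exact_match_def)
    from points_chain[OF False ps(1,2) this] obtain S where
      S: "S \<noteq> []" "set S \<subseteq> set A" "successively weak_prec S" "int (length C) \<le> coverage S"
      using ps(3) by auto
    show ?thesis
    proof (rule max_coverage_eqI[OF S])
      \<comment> \<open>For the upper bound, a chain is turned into points and then into a common
        subsequence, whose length cannot exceed that of \<open>C\<close>.\<close>
      fix S assume "S \<noteq> []" "set S \<subseteq> set A" "successively weak_prec S"
      from chain_points[OF this assms(2)] obtain qs where
        qs: "sorted_wrt below qs" "set qs \<subseteq> points A" "int (length qs) = coverage S"
        by blast
      obtain C' where "restricted_common_subseq A T P C'" "length C' = length qs"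
        using common_subseq_of_points[OF qs(1,2) assms(2,3)] by blast
      then show "coverage S \<le> int (length C)"
        using lcs qs(3) by (auto simp: restricted_lcs_def)
    qed
  qed
qed

end
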